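(* Let $\mathbb D=\{z\in\mathbb C:|z|<1\}$, and let $\lambda:\partial\mathbb D\to\mathbb C$ with $|\lambda(\zeta)|=1$ for all $\zeta$, and $\varphi:\partial\mathbb D\to\mathbb R$ be Lebesgue measurable functions. Let $S$ be the set of all analytic functions $f:\mathbb D\to\mathbb C$ such that for almost every $\zeta\in\partial\mathbb D$, $\mathrm{Re}\,\{\overline{\lambda(\zeta)}\cdot f(z)\}\to\varphi(\zeta)$ as $z\to\zeta$ along any nontangential path in $\mathbb D$ ending at $\zeta$. Then $S$ has infinite dimension, i.e. the real linear span of the differences $f_1-f_2$, $f_1,f_2\in S$, is infinite-dimensional.
   Context: A nontangential path in $\mathbb D$ ending at $\zeta\in\partial\mathbb D$ is a path in $\mathbb D$ tending to $\zeta$ and lying, near $\zeta$, in some Stolz angle $\{z\in\mathbb D: |\arg(1-\bar\zeta z)|<\theta\}$ with $\theta<\pi/2$. The set $S$ is a real affine space; its dimension is that of the real linear space spanned by differences of its elements. *)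

theory Defs
  imports "HOL-Analysis.Analysis"
begin

definition stolz_angle :: "complex \<Rightarrow> real \<Rightarrow> complex set" where
  "stolz_angle \<zeta> \<theta> = {z \<in> ball 0 1. \<bar>Arg (1 - cnj \<zeta> * z)\<bar> < \<theta>}"

definition nontangential_path :: "(real \<Rightarrow> complex) \<Rightarrow> complex \<Rightarrow> bool" where
  "nontangential_path \<gamma> \<zeta> \<longleftrightarrow>
     continuous_on {0..<1} \<gamma> \<and> \<gamma> ` {0..<1} \<subseteq> ball 0 1 \<and>
     (\<gamma> \<longlongrightarrow> \<zeta>) (at_left 1) \<and>
     (\<exists>\<theta>. \<theta> < pi / 2 \<and> (\<forall>\<^sub>F t in at_left 1. \<gamma> t \<in> stolz_angle \<zeta> \<theta>))"

definition nontangential_limit :: "(complex \<Rightarrow> 'a::topological_space) \<Rightarrow> complex \<Rightarrow> 'a \<Rightarrow> bool" where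
  "nontangential_limit g \<zeta> L \<longleftrightarrow>
     (\<forall>\<gamma>. nontangential_path \<gamma> \<zeta> \<longrightarrow> ((\<lambda>t. g (\<gamma> t)) \<longlongrightarrow> L) (at_left 1))"

definition RH_solutions :: "(complex \<Rightarrow> complex) \<Rightarrow> (complex \<Rightarrow> real) \<Rightarrow> (complex \<Rightarrow> complex) set" where
  "RH_solutions lam \<phi> = {f. f holomorphic_on ball 0 1 \<and>
     (AE t in lebesgue. nontangential_limit (\<lambda>z. Re (cnj (lam (cis t)) * f z)) (cis t) (\<phi> (cis t)))}"

end

theory Submission
  imports Defs "HOL-Complex_Analysis.Complex_Analysis"
begin

text \<open>
Let \<open>A\<close> be a trigonometric polynomial, seen as a Laurent polynomial in \<open>z\<close>, and put
\<open>f(z) = G(z^M) A(z)\<close> with \<open>G(w) = -2w/(1-w)\<close>.  Since \<open>Re G = 1\<close> on the unit circle, \<open>A\<close> close to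
\<open>\<lambda> r\<close> with \<open>r\<close> real forces \<open>Re (cnj \<lambda> f)\<close> close to \<open>r\<close> off a small set.  The factor \<open>z^M\<close> cancels the
pole of \<open>A\<close> and makes \<open>f\<close> tiny on compact subsets of the disc for large \<open>M\<close>, while \<open>|G(z^M)|\<close> is
bounded, uniformly in \<open>M\<close>, on nontangential regions at points \<open>\<zeta>\<close> with \<open>|1 - \<zeta>^M| \<ge> \<delta>\<close>.  So \<open>f\<close> is
nontangentially controlled by \<open>|r|\<close> alone, and correcting the residual again and again gives a series
that converges nontangentially almost everywhere, by Borel--Cantelli, to a solution.

Applied to \<open>\<lambda> cnj(\<zeta>)^(N+1)\<close> and a modified \<open>\<phi>\<close>, this yields solutions \<open>z^N (1 + z F(z))\<close> for every \<open>N\<close>;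
consecutive differences vanish at \<open>0\<close> to distinct orders and are therefore independent.
\<close>

section \<open>Laurent polynomials on the circle and approximation of measurable data\<close>

text \<open>On the circle \<open>cnj z = 1 / z\<close>, so \<open>Re z\<close> and
  \<open>Im z\<close> are Laurent polynomials in \<open>z\<close>, and sums and products keep that
  form. Of the numerator only holomorphy on the plane is recorded, so that 0 is the only possible
  pole.\<close>

lemma real_polynomial_function_on_circle:
  fixes p :: "complex \<Rightarrow> real"
  assumes "real_polynomial_function p"
  shows "\<exists>d h. h holomorphic_on UNIV \<and> (\<forall>z. norm z = 1 \<longrightarrow> of_real (p z) = h z / z ^ d)"
  using assms
proof (induction rule: real_polynomial_function.induct)
  case (linear f)
  let ?h = "\<lambda>z::complex. of_real (f 1) * (z\<^sup>2 + 1) / 2 + of_real (f \<i>) * (z\<^sup>2 - 1) / (2 * \<i>)"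
  have "of_real (f z) = ?h z / z ^ 1" if z: "norm z = 1" for z :: complex
  proof -
    interpret bounded_linear f by fact
    have "f z = f (Re z *\<^sub>R 1 + Im z *\<^sub>R \<i>)"
      by (rule arg_cong[of _ _ f]) (simp add: complex_eq_iff)
    then have "f z = Re z * f 1 + Im z * f \<i>"
      by (simp only: add scale real_scaleR_def)
    then have "complex_of_real (f z) = of_real (Re z) * of_real (f 1) + of_real (Im z) * of_real (f \<i>)"
      by simp
    also have "complex_of_real (Re z) = (z + cnj z) / 2"
      by (simp add: complex_eq_iff)
    also have "complex_of_real (Im z) = (z - cnj z) / (2 * \<i>)"
      by (simp add: complex_eq_iff)
    also have "cnj z = 1 / z"
      using z complex_div_cnj[of 1 z] by simp
    also have "(z + 1 / z) / 2 * of_real (f 1) + (z - 1 / z) / (2 * \<i>) * of_real (f \<i>) = ?h z / z ^ 1"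
    proof -
      have "z \<noteq> 0" using z by auto
      then have "z + 1 / z = (z\<^sup>2 + 1) / z" "z - 1 / z = (z\<^sup>2 - 1) / z"
        by (simp_all add: field_simps power2_eq_square)
      then show ?thesis unfolding \<open>z + 1 / z = _\<close> \<open>z - 1 / z = _\<close> using \<open>z \<noteq> 0\<close> by (simp add: divide_simps mult.commute)
    qed
    finally show ?thesis .
  qed
  moreover have "?h holomorphic_on UNIV"
    by (intro holomorphic_intros) auto
  ultimately show ?case by blast
next
  case (const c)
  then show ?case
    by (intro exI[of _ 0] exI[of _ "\<lambda>_. of_real c"]) auto
next
  case (add f g)
  then obtain d h d' h' where h: "h holomorphic_on UNIV" "\<And>z. norm z = 1 \<Longrightarrow> of_real (f z) = h z / z ^ d"
    "h' holomorphic_on UNIV" "\<And>z. norm z = 1 \<Longrightarrow> of_real (g z) = h' z / z ^ d'"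
    by metis
  have "of_real (f z + g z) = (h z * z ^ d' + h' z * z ^ d) / z ^ (d + d')" if "norm z = 1" for z
  proof -
    have "z \<noteq> 0" using that by auto
    then show ?thesis using h(2,4)[OF that] by (simp add: field_simps power_add)
  qed
  moreover have "(\<lambda>z. h z * z ^ d' + h' z * z ^ d) holomorphic_on UNIV"
    by (intro holomorphic_intros h)
  ultimately show ?case by blast
next
  case (mult f g)
  then obtain d h d' h' where h: "h holomorphic_on UNIV" "\<And>z. norm z = 1 \<Longrightarrow> of_real (f z) = h z / z ^ d"
    "h' holomorphic_on UNIV" "\<And>z. norm z = 1 \<Longrightarrow> of_real (g z) = h' z / z ^ d'"
    by metis
  have "of_real (f z * g z) = (h z * h' z) / z ^ (d + d')" if "norm z = 1" for z
    using h(2,4)[OF that] by (simp add: power_add)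
  moreover have "(\<lambda>z. h z * h' z) holomorphic_on UNIV"
    by (intro holomorphic_intros h)
  ultimately show ?case by blast
qed

lemma polynomial_function_on_circle:
  fixes p :: "complex \<Rightarrow> complex"
  assumes "polynomial_function p"
  shows "\<exists>d h. h holomorphic_on UNIV \<and> (\<forall>z. norm z = 1 \<longrightarrow> p z = h z / z ^ d)"
proof -
  have *: "real_polynomial_function (Re \<circ> p)" "real_polynomial_function (Im \<circ> p)"
    using assms bounded_linear_Re bounded_linear_Im unfolding polynomial_function_def by blast+
  obtain d h where h: "h holomorphic_on UNIV" "\<And>z. norm z = 1 \<Longrightarrow> of_real (Re (p z)) = h z / z ^ d"
    using real_polynomial_function_on_circle[OF *(1)] by auto
  obtain d' h' where h': "h' holomorphic_on UNIV" "\<And>z. norm z = 1 \<Longrightarrow> of_real (Im (p z)) = h' z / z ^ d'"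
    using real_polynomial_function_on_circle[OF *(2)] by auto
  have "p z = (h z * z ^ d' + \<i> * h' z * z ^ d) / z ^ (d + d')" if "norm z = 1" for z
  proof -
    have "z \<noteq> 0" using that by auto
    then show ?thesis using complex_eq[of "p z"] unfolding h(2)[OF that] h'(2)[OF that]
      by (simp add: divide_simps power_add mult.assoc)
  qed
  moreover have "(\<lambda>z. h z * z ^ d' + \<i> * h' z * z ^ d) holomorphic_on UNIV"
    by (intro holomorphic_intros h h')
  ultimately show ?thesis by blast
qed

text \<open>\<open>g\<close> need not have period \<open>2 * pi\<close>, so
  \<open>g \<circ> Arg\<close> may jump at -1. Once an arc around -1 is cut out, it is continuous on
  a compact set and Stone-Weierstrass applies.\<close>

lemma continuous_approx_on_arc:
  fixes g :: "real \<Rightarrow> complex"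
  assumes g: "continuous_on UNIV g" and "0 < \<epsilon>" "0 < \<eta>"
  obtains h d where "h holomorphic_on UNIV"
    "\<And>t. \<bar>t\<bar> \<le> pi - \<eta> \<Longrightarrow> norm (g t - h (cis t) / cis t ^ d) < \<epsilon>"
proof -
  let ?S = "cis ` {-(pi-\<eta>)..pi-\<eta>}"
  have Arg: "Arg (cis t) = t" if "t \<in> {-(pi-\<eta>)..pi-\<eta>}" for t
    using that \<open>0 < \<eta>\<close> by (intro Arg_cis) auto
  have "compact ?S"
    by (intro compact_continuous_image continuous_intros) auto
  moreover have "continuous_on ?S (g \<circ> Arg)"
  proof (rule continuous_on_compose)
    have "isCont Arg (cis t)" if "t \<in> {-(pi-\<eta>)..pi-\<eta>}" for t
    proof (rule continuous_at_Arg)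
      show "cis t \<notin> \<real>\<^sub>\<le>\<^sub>0"
      proof
        assume "cis t \<in> \<real>\<^sub>\<le>\<^sub>0"
        then have "Re (cis t) \<le> 0" "Im (cis t) = 0"
          by (auto simp: complex_nonpos_Reals_iff)
        moreover have "Re (cis t) \<noteq> 0"
          using sin_zero_abs_cos_one[of t] \<open>Im (cis t) = 0\<close> by auto
        ultimately have "Re (cis t) < 0" "Im (cis t) = 0" by auto
        then have "Arg (cis t) = pi" by (simp add: Arg_eq_pi)
        with Arg[OF that] that \<open>0 < \<eta>\<close> show False by auto
      qed
    qed
    then show "continuous_on ?S Arg"
      by (auto intro!: continuous_at_imp_continuous_on)
    show "continuous_on (Arg ` ?S) g"
      using g continuous_on_subset by blast
  qed
  ultimately have "\<exists>p. polynomial_function p \<and> (\<forall>x\<in>?S. norm ((g \<circ> Arg) x - p x) < \<epsilon>)"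
    using \<open>0 < \<epsilon>\<close> by (rule Stone_Weierstrass_polynomial_function)
  then obtain p where "polynomial_function p" and p: "\<And>x. x \<in> ?S \<Longrightarrow> norm ((g \<circ> Arg) x - p x) < \<epsilon>"
    by auto
  from polynomial_function_on_circle[OF this(1)]
  obtain d h where h: "h holomorphic_on UNIV" "\<And>z. norm z = 1 \<Longrightarrow> p z = h z / z ^ d"
    by auto
  show thesis
  proof
    show "h holomorphic_on UNIV" by fact
    show "norm (g t - h (cis t) / cis t ^ d) < \<epsilon>" if "\<bar>t\<bar> \<le> pi - \<eta>" for t
    proof -
      have t: "t \<in> {-(pi-\<eta>)..pi-\<eta>}" using that by auto
      show ?thesis
        using p[OF imageI[OF t]] h(2)[of "cis t"] Arg[OF t] by simp
    qed
  qed
qed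

text \<open>An approximate form of Lusin's theorem, by the argument of Egorov: continuous functions
  converge to \<open>u\<close> off a null set, so the sets where some late one is still
  \<open>\<epsilon>\<close>-far from \<open>u\<close> shrink to a null set.\<close>

lemma measurable_approx_continuous:
  fixes u :: "real \<Rightarrow> complex"
  assumes u: "u \<in> borel_measurable lebesgue" and "0 < \<epsilon>" "0 < a"
  obtains g B where "continuous_on UNIV g" "B \<in> lmeasurable" "measure lebesgue B < a"
    "\<And>t. t \<in> {-pi..pi} - B \<Longrightarrow> norm (u t - g t) < \<epsilon>"
proof -
  have "u measurable_on UNIV"
    using u lebesgue_measurable_imp_measurable_on[of u UNIV] by simp
  then obtain N g where N: "negligible N" and g: "\<And>n. continuous_on UNIV (g n)"
    and lim: "\<And>x. x \<notin> N \<Longrightarrow> (\<lambda>n. g n x) \<longlonglongrightarrow> u x"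
    unfolding measurable_on_def by auto
  have [measurable]: "u \<in> borel_measurable lebesgue" by fact
  have [measurable]: "g n \<in> borel_measurable lebesgue" for n
    by (intro measurable_completion) (simp add: borel_measurable_continuous_onI g)
  \<comment> \<open>Restricting to one period gives \<open>D n\<close> finite measure, as continuity
    of measure from above requires.\<close>
  define D where "D n = {t \<in> {-pi..pi}. \<exists>m\<ge>n. \<epsilon> \<le> norm (u t - g m t)}" for n
  have D: "D n \<in> lmeasurable" for n
  proof (rule bounded_set_imp_lmeasurable)
    show "bounded (D n)"
      by (rule bounded_subset[of "{-pi..pi}"]) (auto simp: D_def)
    have "{t \<in> space lebesgue. \<exists>m\<in>{n..}. \<epsilon> \<le> norm (u t - g m t)} \<in> sets lebesgue"
      by measurable
    then have "{-pi..pi} \<inter> {t \<in> space lebesgue. \<exists>m\<in>{n..}. \<epsilon> \<le> norm (u t - g m t)} \<in> sets lebesgue"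
      by (intro sets.Int) auto
    also have "{-pi..pi} \<inter> {t \<in> space lebesgue. \<exists>m\<in>{n..}. \<epsilon> \<le> norm (u t - g m t)} = D n"
      by (auto simp: D_def)
    finally show "D n \<in> sets lebesgue" .
  qed
  have "(\<lambda>n. measure lebesgue (D n)) \<longlonglongrightarrow> measure lebesgue (\<Inter>n. D n)"
  proof (rule Lim_measure_decseq)
    show "range D \<subseteq> sets lebesgue" using D by auto
    show "decseq D" unfolding decseq_def D_def by (blast intro: order_trans)
    show "emeasure lebesgue (D i) \<noteq> \<infinity>" for i
      using fmeasurableD2[OF D[of i]] unfolding infinity_ennreal_def .
  qed
  moreover have "(\<Inter>n. D n) \<subseteq> N"
  proof
    fix x assume x: "x \<in> (\<Inter>n. D n)"
    show "x \<in> N"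
    proof (rule ccontr)
      assume "x \<notin> N"
      from tendstoD[OF lim[OF this] \<open>0 < \<epsilon>\<close>] obtain n where "\<And>m. m \<ge> n \<Longrightarrow> dist (g m x) (u x) < \<epsilon>"
        by (auto simp: eventually_sequentially)
      moreover have "x \<in> D n" using x by auto
      ultimately show False unfolding D_def dist_norm
        by (auto simp: norm_minus_commute not_le[symmetric])
    qed
  qed
  then have "measure lebesgue (\<Inter>n. D n) = 0"
    using N negligible_imp_measure0 negligible_subset by blast
  ultimately have "\<forall>\<^sub>F n in sequentially. measure lebesgue (D n) < a"
    using \<open>0 < a\<close> order_tendstoD(2) by fastforce
  then obtain n where "measure lebesgue (D n) < a"
    by (auto simp: eventually_sequentially)
  moreover have "norm (u t - g n t) < \<epsilon>" if "t \<in> {-pi..pi} - D n" for t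
  proof (rule ccontr)
    assume "\<not> norm (u t - g n t) < \<epsilon>"
    then have "t \<in> D n" using that unfolding D_def by (auto intro!: exI[of _ n])
    then show False using that by simp
  qed
  ultimately show thesis
    using that[OF g D] by blast
qed

lemma measurable_approx:
  fixes u :: "real \<Rightarrow> complex"
  assumes u: "u \<in> borel_measurable lebesgue" and "0 < \<epsilon>" "0 < a"
  obtains h d B where "h holomorphic_on UNIV" "B \<in> lmeasurable" "measure lebesgue B < a"
    "\<And>t. t \<in> {-pi..pi} - B \<Longrightarrow> norm (u t - h (cis t) / cis t ^ d) < \<epsilon>"
proof -
  obtain g B where g: "continuous_on UNIV g" and B: "B \<in> lmeasurable" "measure lebesgue B < a/2"
    "\<And>t. t \<in> {-pi..pi} - B \<Longrightarrow> norm (u t - g t) < \<epsilon>/2"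
    using measurable_approx_continuous[OF u, of "\<epsilon>/2" "a/2"] assms by auto
  \<comment> \<open>The two end intervals of length \<open>\<eta>\<close> cost \<open>a / 2\<close>
    together, the half of the budget that \<open>B\<close> leaves.\<close>
  define \<eta> where "\<eta> = a/4"
  have "\<eta> > 0" using assms by (simp add: \<eta>_def)
  obtain d h where h: "h holomorphic_on UNIV"
    "\<And>t. \<bar>t\<bar> \<le> pi - \<eta> \<Longrightarrow> norm (g t - h (cis t) / cis t ^ d) < \<epsilon>/2"
    using continuous_approx_on_arc[OF g, of "\<epsilon>/2" \<eta>] assms \<open>\<eta> > 0\<close> by auto
  let ?B = "B \<union> ({-pi..-pi+\<eta>} \<union> {pi-\<eta>..pi})"
  have "measure lebesgue ?B \<le> measure lebesgue B + measure lebesgue ({-pi..-pi+\<eta>} \<union> {pi-\<eta>..pi})"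
    using B by (intro measure_Un_le) auto
  also have "measure lebesgue ({-pi..-pi+\<eta>} \<union> {pi-\<eta>..pi}) \<le> measure lebesgue {-pi..-pi+\<eta>} + measure lebesgue {pi-\<eta>..pi}"
    by (intro measure_Un_le) auto
  also have "\<dots> = 2 * \<eta>" using \<open>\<eta> > 0\<close> by simp
  finally have "measure lebesgue ?B < a" using B by (simp add: \<eta>_def)
  moreover have "?B \<in> lmeasurable" using B by auto
  moreover have "norm (u t - h (cis t) / cis t ^ d) < \<epsilon>" if "t \<in> {-pi..pi} - ?B" for t
  proof -
    have "\<bar>t\<bar> \<le> pi - \<eta>" using that by auto
    from h(2)[OF this] B(3)[of t] that show ?thesis
      by (smt (verit, best) DiffD1 DiffD2 DiffI UnCI field_sum_of_halves norm_diff_triangle_less)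
  qed
  ultimately show thesis using that h(1) by blast
qed

section \<open>The kernel \<open>- 2 * w / (1 - w)\<close> at \<open>w = z ^ M\<close>\<close>

text \<open>\<open>\<delta>\<close> can be independent of \<open>M\<close>: the \<open>t\<close>
  with \<open>cis t ^ M\<close> near 1 are covered by a number of intervals proportional to
  \<open>M\<close>, each of length proportional to \<open>1 / M\<close>.\<close>

lemma near_roots_of_unity_small:
  assumes "0 < a"
  obtains \<delta> where "0 < \<delta>"
    "\<And>M::nat. M > 0 \<Longrightarrow> \<exists>B. B \<in> lmeasurable \<and> measure lebesgue B < a \<and>
       (\<forall>t\<in>{-pi..pi} - B. \<delta> \<le> norm (1 - cis t ^ M))"
proof -
  \<comment> \<open>\<open>2 * M + 1\<close> intervals of length \<open>2 * b / M\<close> add up to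
    at most \<open>6 * b < a\<close>, and \<open>b \<le> pi\<close> keeps the indices that occur
    between \<open>- M\<close> and \<open>M\<close>.\<close>
  define b where "b = min pi (a / 7)"
  have b: "0 < b" "b \<le> pi" "6 * b < a" using assms by (auto simp: b_def min_def)
  have "isCont Arg 1" by (rule continuous_at_Arg) (simp add: complex_nonpos_Reals_iff)
  then have "\<exists>d>0. \<forall>z. dist z 1 < d \<longrightarrow> dist (Arg z) (Arg 1) < b"
    unfolding continuous_at_eps_delta using b by blast
  then obtain \<delta> where \<delta>: "\<delta> > 0" "\<And>z. norm (1 - z) < \<delta> \<Longrightarrow> \<bar>Arg z\<bar> < b"
    by (auto simp: dist_norm norm_minus_commute)
  show thesis
  proof
    fix M :: nat assume "M > 0"
    define I where "I j = {(2*pi*real_of_int j - b)/M..(2*pi*real_of_int j + b)/M}" for j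
    let ?J = "{- int M..int M}"
    have I: "measure lebesgue (I j) = 2 * b / M" for j
      using b \<open>M > 0\<close> unfolding I_def by (simp add: divide_right_mono) (simp add: field_simps)
    have "measure lebesgue (\<Union>j\<in>?J. I j) \<le> (\<Sum>j\<in>?J. measure lebesgue (I j))"
      by (intro measure_UNION_le) (auto simp: I_def)
    also have "\<dots> = (2 * real M + 1) * (2 * b / M)" by (simp add: I)
    also have "\<dots> \<le> 6 * b" using \<open>M > 0\<close> b by (simp add: field_simps)
    finally have "measure lebesgue (\<Union>j\<in>?J. I j) < a" using b by simp
    moreover have "(\<Union>j\<in>?J. I j) \<in> lmeasurable"
      by (intro fmeasurable.finite_UN) (auto simp: I_def)
    moreover have "t \<in> (\<Union>j\<in>?J. I j)" if t: "t \<in> {-pi..pi}" and "\<not> \<delta> \<le> norm (1 - cis t ^ M)" for t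
    proof -
      have "\<bar>Arg (cis (M * t))\<bar> < b" using \<delta>(2) that by (simp add: Complex.DeMoivre)
      moreover obtain k where k: "M * t - of_int k * (2 * pi) = Arg (cis (M * t))"
        using Arg_exp_diff_2pi[of "\<i> * of_real (M * t)"] by (auto simp: cis_conv_exp)
      ultimately have *: "\<bar>M * t - of_int k * (2 * pi)\<bar> < b" by simp
      have "\<bar>M * t\<bar> \<le> M * pi" using t \<open>M > 0\<close> by (simp add: abs_mult mult_left_mono abs_le_iff)
      then have "\<bar>of_int k * (2 * pi)\<bar> < M * pi + b" using * by linarith
      also have "\<dots> \<le> (M + M) * pi" using b \<open>M > 0\<close>
        by (auto simp: algebra_simps intro!: order_trans[OF b(2)])
      finally have "\<bar>real_of_int k\<bar> * (2 * pi) < M * (2 * pi)" by (simp add: abs_mult algebra_simps)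
      then have "\<bar>real_of_int k\<bar> < M" by simp
      then have "k \<in> ?J" by auto
      moreover have "t \<in> I k" using * \<open>M > 0\<close> by (auto simp: I_def field_simps abs_less_iff)
      ultimately show ?thesis by blast
    qed
    ultimately show "\<exists>B. B \<in> lmeasurable \<and> measure lebesgue B < a \<and>
       (\<forall>t\<in>{-pi..pi} - B. \<delta> \<le> norm (1 - cis t ^ M))" by blast
  qed (use \<delta> in auto)
qed

text \<open>A Stolz region given by a distance inequality of aperture \<open>K\<close> instead of an
  angle. It is taken in the closed disc so that, for \<open>norm \<zeta> = 1\<close>, it contains
  \<open>\<zeta>\<close> and estimates on it include the boundary value.\<close>

definition nt_region :: "real \<Rightarrow> complex \<Rightarrow> complex set" where
  "nt_region K \<zeta> = {z \<in> cball 0 1. norm (\<zeta> - z) \<le> K * (1 - norm z)}"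

text \<open>Either \<open>z ^ M\<close> is close to \<open>\<zeta> ^ M\<close>, hence away from 1,
  or \<open>z\<close> is far from \<open>\<zeta>\<close> on the scale \<open>1 / M\<close>; in the
  region this bounds \<open>M * (1 - norm z)\<close> from below and keeps \<open>norm z ^ M\<close>
  away from 1. The resulting bound is free of \<open>M\<close>.\<close>

lemma norm_one_minus_power_ge:
  fixes z \<zeta> :: complex
  assumes \<zeta>: "norm \<zeta> = 1" and z: "z \<in> nt_region K \<zeta>" and K: "1 \<le> K"
    and \<delta>: "\<delta> \<le> norm (1 - \<zeta> ^ M)"
  shows "\<delta> / (2 * K + 2) \<le> norm (1 - z ^ M)"
proof (cases "\<delta> \<le> 0")
  case True
  then have "\<delta> / (2 * K + 2) \<le> 0" using K by (simp add: divide_nonpos_pos)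
  then show ?thesis using norm_ge_zero order_trans by blast
next
  case False
  have z1: "norm z \<le> 1" and zK: "norm (\<zeta> - z) \<le> K * (1 - norm z)"
    using z by (auto simp: nt_region_def)
  have \<delta>2: "\<delta> \<le> 2"
    using \<delta> norm_triangle_ineq4[of 1 "\<zeta> ^ M"] \<zeta> by (simp add: norm_power)
  show ?thesis
  proof (cases "norm (z ^ M - \<zeta> ^ M) \<le> \<delta> / 2")
    case True
    have "norm (1 - \<zeta> ^ M) \<le> norm (1 - z ^ M) + norm (z ^ M - \<zeta> ^ M)"
      using norm_triangle_ineq[of "1 - z ^ M" "z ^ M - \<zeta> ^ M"] by simp
    then have "\<delta> / 2 \<le> norm (1 - z ^ M)" using True \<delta> by simp
    moreover have "\<delta> / (2 * K + 2) \<le> \<delta> / 2"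
      using K False by (intro divide_left_mono) auto
    ultimately show ?thesis by linarith
  next
    case nle: False
    define s where "s = M * (1 - norm z)"
    have s0: "0 \<le> s" using z1 by (simp add: s_def)
    have "norm (z ^ M - \<zeta> ^ M) \<le> M * norm (z - \<zeta>)"
      using z1 \<zeta> by (intro norm_power_diff) auto
    also have "\<dots> \<le> M * (K * (1 - norm z))"
      using zK by (intro mult_left_mono) (auto simp: norm_minus_commute)
    also have "\<dots> = K * s" by (simp add: s_def)
    finally have "\<delta> < 2 * K * s" using nle by simp
    have "norm z ^ M \<le> exp (- (1 - norm z)) ^ M"
      using exp_ge_add_one_self[of "- (1 - norm z)"] by (intro power_mono) auto
    also have "\<dots> = exp (- s)" by (simp add: s_def exp_of_nat_mult[symmetric] algebra_simps)
    also have "\<dots> \<le> 1 / (1 + s)"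
      using exp_ge_add_one_self[of s] s0 by (simp add: exp_minus field_simps)
    finally have "s / (1 + s) \<le> 1 - norm z ^ M" using s0 by (simp add: field_simps)
    moreover have "\<delta> / (2 * K + 2) \<le> s / (1 + s)"
    proof -
      have "\<delta> * (1 + s) = \<delta> + \<delta> * s" by (simp add: algebra_simps)
      also have "\<dots> \<le> 2 * K * s + 2 * s"
        using \<open>\<delta> < 2 * K * s\<close> mult_right_mono[OF \<delta>2 s0] by linarith
      finally have "\<delta> * (1 + s) \<le> s * (2 * K + 2)" by (simp add: algebra_simps)
      then show ?thesis using K s0 by (simp add: divide_simps)
    qed
    moreover have "1 - norm z ^ M \<le> norm (1 - z ^ M)"
      using norm_triangle_ineq2[of 1 "z ^ M"] by (simp add: norm_power)
    ultimately show ?thesis by linarith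
  qed
qed

text \<open>The kernel is \<open>1 - (1 + w) / (1 - w)\<close>, and this Cayley transform is purely
  imaginary on the circle. The computation adds the conjugate, which is \<open>2 / (1 - w)\<close>
  because \<open>cnj w = 1 / w\<close>.\<close>

lemma Re_block_circle:
  fixes w :: complex
  assumes "norm w = 1" "w \<noteq> 1"
  shows "Re (- 2 * w / (1 - w)) = 1"
proof -
  have "w \<noteq> 0" using assms by auto
  have "cnj w = 1 / w" using assms complex_div_cnj[of 1 w] by simp
  then have "cnj (- 2 * w / (1 - w)) = - 2 * (1 / w) / (1 - 1 / w)" by simp
  also have "\<dots> = 2 / (1 - w)"
    using assms \<open>w \<noteq> 0\<close> by (simp add: divide_simps algebra_simps)
  finally have "- 2 * w / (1 - w) + cnj (- 2 * w / (1 - w)) = - 2 * w / (1 - w) + 2 / (1 - w)"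
    by simp
  also have "\<dots> = (2 * (1 - w)) / (1 - w)"
    by (subst add_divide_distrib[symmetric]) (simp add: algebra_simps)
  also have "\<dots> = 2" using assms by (intro nonzero_mult_div_cancel_right) simp
  finally have "complex_of_real (2 * Re (- 2 * w / (1 - w))) = 2"
    by (simp only: complex_add_cnj)
  from arg_cong[OF this, of Re] have "2 * Re (- 2 * w / (1 - w)) = 2"
    by (simp only: Re_complex_of_real complex_Re_numeral)
  then show ?thesis by simp
qed

text \<open>Used to see that the boundary singularities of a correction form a null set.\<close>

lemma countable_roots_of_unity:
  assumes "M > 0"
  shows "countable {t. cis t ^ M = 1}"
proof -
  have "{t. cis t ^ M = 1} \<subseteq> range (\<lambda>k::int. 2 * pi * k / M)"
  proof
    fix t assume "t \<in> {t. cis t ^ M = 1}"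
    then have "cis (M * t) = 1" by (simp add: Complex.DeMoivre)
    then have "exp (\<i> * of_real (M * t)) = 1" by (simp only: cis_conv_exp)
    then obtain k :: int where "M * t = of_int (2 * k) * pi" by (auto simp: exp_eq_1)
    then have "t = 2 * pi * k / M" using assms by (simp add: field_simps)
    then show "t \<in> range (\<lambda>k::int. 2 * pi * k / M)" by blast
  qed
  then show ?thesis by (rule countable_subset) simp
qed

section \<open>One correction of the residual\<close>

text \<open>\<open>r\<close> is the residual to be removed and \<open>B\<close> the exceptional set.
  The last clause drives the convergence: on the whole region at \<open>cis t\<close>,
  \<open>f\<close> is controlled by the residual at that single point. Measurability passes on to
  the next residual; continuity at almost every boundary point gives limits of the partial
  sums.\<close>

definition correction ::
  "(real \<Rightarrow> complex) \<Rightarrow> (real \<Rightarrow> real) \<Rightarrow> real \<Rightarrow> real \<Rightarrow> real \<Rightarrow> real \<Rightarrow> (complex \<Rightarrow> complex) \<Rightarrow> real set \<Rightarrow> bool"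
  where "correction lam r a K C e f B \<longleftrightarrow>
    f holomorphic_on ball 0 1 \<and> (\<forall>z. norm z \<le> 1 - e \<longrightarrow> norm (f z) \<le> e) \<and>
    (\<lambda>t. f (cis t)) \<in> borel_measurable lebesgue \<and> (AE t in lebesgue. isCont f (cis t)) \<and>
    B \<in> lmeasurable \<and> measure lebesgue B < a \<and>
    (\<forall>t\<in>{-pi..pi} - B. \<bar>r t - Re (cnj (lam t) * f (cis t))\<bar> \<le> e \<and>
      (\<forall>z\<in>nt_region K (cis t). norm (f z) \<le> C * (\<bar>r t\<bar> + e)))"

text \<open>The amplification factor \<open>C\<close> depends on the exceptional measure \<open>a\<close> and the aperture \<open>K\<close>, but
not on the accuracy \<open>e\<close>; this lets the accuracies be chosen after all the factors.\<close>

lemma correction_exists: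
  fixes a K :: real
  assumes a: "0 < a" and K: "1 \<le> K"
  shows "\<exists>C\<ge>1. \<forall>lam r e. lam \<in> borel_measurable lebesgue \<longrightarrow> (\<forall>t. norm (lam t) = 1) \<longrightarrow>
    r \<in> borel_measurable lebesgue \<longrightarrow> 0 < e \<longrightarrow> e \<le> 1/2 \<longrightarrow> (\<exists>f B. correction lam r a K C e f B)"
proof -
  obtain \<delta> where "0 < \<delta>" and \<delta>: "\<And>M::nat. M > 0 \<Longrightarrow> \<exists>B. B \<in> lmeasurable \<and> measure lebesgue B < a/2 \<and>
       (\<forall>t\<in>{-pi..pi} - B. \<delta> \<le> norm (1 - cis t ^ M))"
    using near_roots_of_unity_small[of "a/2"] a by auto
  \<comment> \<open>The second term bounds the kernel at \<open>z ^ M\<close> on regions of aperture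
    \<open>K\<close>; the 1 serves the points where \<open>f\<close> itself is at most
    \<open>e\<close>.\<close>
  define C where "C = max 1 (2 * (2 * K + 2) / \<delta>)"
  show ?thesis
  proof (intro exI[of _ C] conjI allI impI)
    show "1 \<le> C" by (simp add: C_def)
    fix lam :: "real \<Rightarrow> complex" and r :: "real \<Rightarrow> real" and e :: real
    assume lam: "lam \<in> borel_measurable lebesgue" "\<forall>t. norm (lam t) = 1"
      and r: "r \<in> borel_measurable lebesgue" and e: "0 < e" "e \<le> 1/2"
    \<comment> \<open>Two errors of size \<open>e / 2\<close> will separate \<open>A z\<close> from
      \<open>u t\<close>; \<open>e * \<delta> / 2\<close> offsets the bound
      \<open>2 / \<delta>\<close> of the kernel on the circle.\<close>
    define e' where "e' = min (e/2) (e * \<delta> / 2)"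
    have e': "0 < e'" "e' \<le> e/2" "e' \<le> e * \<delta> / 2" using e \<open>0 < \<delta>\<close> by (auto simp: e'_def)
    define u where "u t = lam t * complex_of_real (r t)" for t
    have "u \<in> borel_measurable lebesgue"
      unfolding u_def using lam r by measurable
    then obtain d h B1 where h: "h holomorphic_on UNIV"
      and B1: "B1 \<in> lmeasurable" "measure lebesgue B1 < a/2"
        "\<And>t. t \<in> {-pi..pi} - B1 \<Longrightarrow> norm (u t - h (cis t) / cis t ^ d) < e'"
      by (rule measurable_approx[OF _ e'(1) half_gt_zero[OF a]]) blast
    define A where "A z = h z / z ^ d" for z
    \<comment> \<open>This closed annulus avoids the pole of \<open>A\<close> at 0.\<close>
    let ?N = "cball (0::complex) 1 - ball 0 (1/2)"
    have conth: "continuous_on S h" for S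
      using h holomorphic_on_imp_continuous_on continuous_on_subset by blast
    have "continuous_on ?N A"
      unfolding A_def by (intro continuous_intros conth) auto
    moreover have "compact ?N" by (intro compact_diff) auto
    ultimately have "uniformly_continuous_on ?N A"
      by (rule compact_uniformly_continuous)
    then obtain \<eta> where \<eta>: "\<eta> > 0" "\<And>x y. x \<in> ?N \<Longrightarrow> y \<in> ?N \<Longrightarrow> dist y x < \<eta> \<Longrightarrow> dist (A y) (A x) < e'"
      using \<open>0 < e'\<close> unfolding uniformly_continuous_on_def by metis
    \<comment> \<open>Points of the region at \<open>cis t\<close> outside radius
      \<open>\<rho>\<close> lie within \<open>\<eta>\<close> of \<open>cis t\<close>; inside that
      radius \<open>f\<close> will be made at most \<open>e\<close>.\<close>
    define \<rho> where "\<rho> = max (1 - e) (1 - \<eta> / K)"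
    have \<rho>: "1 - e \<le> \<rho>" "1/2 \<le> \<rho>" "\<rho> < 1" "K * (1 - \<rho>) \<le> \<eta>"
    proof -
      have "0 < \<eta> / K" using \<eta>(1) K by simp
      then show "1 - e \<le> \<rho>" "1/2 \<le> \<rho>" "\<rho> < 1" using e unfolding \<rho>_def by linarith+
      have "1 - \<rho> \<le> \<eta> / K" by (simp add: \<rho>_def)
      then show "K * (1 - \<rho>) \<le> \<eta>" using K by (simp add: field_simps)
    qed
    have "bounded (h ` cball 0 1)"
      by (intro compact_imp_bounded compact_continuous_image conth) auto
    then obtain S where S: "S > 0" "\<And>z. norm z \<le> 1 \<Longrightarrow> norm (h z) \<le> S"
      unfolding bounded_pos by auto
    have "(\<lambda>k. 2 * S / (1 - \<rho>) * \<rho> ^ k) \<longlonglongrightarrow> 2 * S / (1 - \<rho>) * 0"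
      using \<rho> by (intro tendsto_intros LIMSEQ_realpow_zero) auto
    then have "\<forall>\<^sub>F k in sequentially. 2 * S / (1 - \<rho>) * \<rho> ^ k < e"
      using e order_tendstoD(2) by fastforce
    then obtain k0 where k0: "\<And>k. k \<ge> k0 \<Longrightarrow> 2 * S / (1 - \<rho>) * \<rho> ^ k < e"
      by (auto simp: eventually_sequentially)
    \<comment> \<open>The successor ensures \<open>M > 0\<close> even if \<open>k0\<close> and
      \<open>d\<close> vanish.\<close>
    define k where "k = Suc k0"
    have k: "2 * S / (1 - \<rho>) * \<rho> ^ k < e" using k0[of k] by (simp add: k_def)
    define M where "M = k + d"
    have "M > 0" by (simp add: M_def k_def)
    \<comment> \<open>The kernel at \<open>z ^ M\<close> times \<open>A z\<close>, with
      \<open>z ^ d\<close> cancelled so that 0 is a regular point. Where \<open>z ^ M = 1\<close>,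
      division by zero gives the value 0; on the circle this affects only a null set of
      \<open>t\<close>.\<close>
    define f where "f z = - 2 * (z ^ k * h z) / (1 - z ^ M)" for z
    have f_A: "f z = - 2 * z ^ M / (1 - z ^ M) * A z" if "z \<noteq> 0" for z
      using that by (simp add: f_def A_def M_def power_add)
    obtain B2 where B2: "B2 \<in> lmeasurable" "measure lebesgue B2 < a/2"
       "\<And>t. t\<in>{-pi..pi} - B2 \<Longrightarrow> \<delta> \<le> norm (1 - cis t ^ M)"
      using \<delta>[OF \<open>M > 0\<close>] by blast
    have pow_ne: "z ^ M \<noteq> 1" if "norm z < 1" for z :: complex
    proof
      assume "z ^ M = 1"
      then have "norm z ^ M = 1" by (metis norm_one norm_power)
      moreover have "norm z ^ M < 1" using that \<open>M > 0\<close> by (simp add: power_less_one_iff)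
      ultimately show False by simp
    qed
    have small: "norm (f z) \<le> e" if "norm z \<le> \<rho>" for z
    proof -
      have z1: "norm z \<le> 1" using that \<rho> by simp
      have "norm z ^ M \<le> norm z ^ 1"
        using z1 \<open>M > 0\<close> by (intro power_decreasing) auto
      then have den: "1 - \<rho> \<le> norm (1 - z ^ M)"
        using norm_triangle_ineq2[of 1 "z ^ M"] that by (simp add: norm_power)
      have "norm (f z) = 2 * (norm z ^ k * norm (h z)) / norm (1 - z ^ M)"
        by (simp add: f_def norm_divide norm_mult norm_power)
      also have "\<dots> \<le> 2 * (\<rho> ^ k * S) / (1 - \<rho>)"
        using den \<rho> S z1 that by (intro frac_le mult_left_mono mult_mono power_mono) auto
      also have "\<dots> = 2 * S / (1 - \<rho>) * \<rho> ^ k" by simp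
      also note k
      finally show ?thesis by simp
    qed
    show "\<exists>f B. correction lam r a K C e f B"
      unfolding correction_def
    proof (intro exI conjI)
      show "f holomorphic_on ball 0 1"
        unfolding f_def using pow_ne
        by (intro holomorphic_intros holomorphic_on_subset[OF h]) auto
      show "\<forall>z. norm z \<le> 1 - e \<longrightarrow> norm (f z) \<le> e"
        using small \<rho> by force
      have "continuous_on UNIV (\<lambda>t. - 2 * (cis t ^ k * h (cis t)))" "continuous_on UNIV (\<lambda>t. 1 - cis t ^ M)"
        by (auto intro!: continuous_intros continuous_on_compose2[OF conth])
      then have "(\<lambda>t. - 2 * (cis t ^ k * h (cis t))) \<in> borel_measurable borel" 
        "(\<lambda>t. 1 - cis t ^ M) \<in> borel_measurable borel"
        by - (rule borel_measurable_continuous_onI, assumption)+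
      then have "(\<lambda>t. f (cis t)) \<in> borel_measurable borel"
        unfolding f_def by (rule borel_measurable_divide)
      then show "(\<lambda>t. f (cis t)) \<in> borel_measurable lebesgue"
        by (intro measurable_completion) simp
      have "{t. cis t ^ M = 1} \<in> null_sets lebesgue"
        by (intro null_sets_completionI countable_imp_null_set_lborel countable_roots_of_unity \<open>M > 0\<close>)
      moreover have "isCont f (cis t)" if "cis t ^ M \<noteq> 1" for t
      proof -
        have "isCont h (cis t)"
          using conth[of UNIV] by (simp add: continuous_on_eq_continuous_at)
        then show ?thesis
          unfolding f_def using that by (intro continuous_intros) auto
      qed
      ultimately show "AE t in lebesgue. isCont f (cis t)"
        by (intro AE_I'[of "{t. cis t ^ M = 1}"]) auto
      show "B1 \<union> B2 \<in> lmeasurable" using B1 B2 by auto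
      show "measure lebesgue (B1 \<union> B2) < a"
        using measure_Un_le[of B1 lebesgue B2] B1 B2 by (simp add: fmeasurableD)
      show "\<forall>t\<in>{-pi..pi} - (B1 \<union> B2). \<bar>r t - Re (cnj (lam t) * f (cis t))\<bar> \<le> e \<and>
          (\<forall>z\<in>nt_region K (cis t). norm (f z) \<le> C * (\<bar>r t\<bar> + e))"
      proof (intro ballI conjI)
        fix t assume t: "t \<in> {-pi..pi} - (B1 \<union> B2)"
        then have uA: "norm (u t - A (cis t)) < e'" and \<delta>t: "\<delta> \<le> norm (1 - cis t ^ M)"
          using B1(3)[of t] B2(3)[of t] by (auto simp: A_def)
        define w where "w = cis t ^ M"
        define G where "G = - 2 * w / (1 - w)"
        have w: "norm w = 1" "w \<noteq> 1" using \<delta>t \<open>0 < \<delta>\<close> by (auto simp: w_def norm_power)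
        have ReG: "Re G = 1" unfolding G_def using w by (rule Re_block_circle)
        have "norm G = 2 / norm (1 - w)" using w by (simp add: G_def norm_divide norm_mult)
        also have "\<dots> \<le> 2 / \<delta>" using \<delta>t \<open>0 < \<delta>\<close> w
          by (intro divide_left_mono mult_pos_pos) (auto simp: w_def)
        finally have nG: "norm G \<le> 2 / \<delta>" .
        have fG: "f (cis t) = G * A (cis t)" using f_A[of "cis t"] by (simp add: G_def w_def)
        \<comment> \<open>With \<open>u\<close> in place of \<open>A\<close> the product with
          \<open>cnj (lam t)\<close> is \<open>r t * G\<close>, whose real part is exactly
          \<open>r t\<close>. The new residual therefore comes only from
          \<open>u t - A (cis t)\<close>.\<close>
        have "cnj (lam t) * lam t = 1"
          using lam(2) by (simp add: complex_norm_square[symmetric] mult.commute)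
        then have "cnj (lam t) * u t = of_real (r t)"
          by (simp add: u_def flip: mult.assoc)
        then have "cnj (lam t) * (G * u t) = of_real (r t) * G"
          by (metis mult.commute mult.assoc)
        then have "Re (cnj (lam t) * (G * u t)) = Re (of_real (r t) * G)" by (rule arg_cong)
        also have "\<dots> = r t" using ReG by simp
        finally have "Re (cnj (lam t) * (G * u t)) = r t" .
        then have "r t - Re (cnj (lam t) * f (cis t)) = Re (cnj (lam t) * (G * (u t - A (cis t))))"
          by (simp add: fG right_diff_distrib)
        then have "\<bar>r t - Re (cnj (lam t) * f (cis t))\<bar> \<le> norm (cnj (lam t) * (G * (u t - A (cis t))))"
          using abs_Re_le_cmod by metis
        also have "\<dots> = norm G * norm (u t - A (cis t))" using lam(2) by (simp add: norm_mult)
        also have "\<dots> \<le> 2 / \<delta> * e'" using nG uA \<open>0 < \<delta>\<close> by (intro mult_mono) auto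
        also have "\<dots> \<le> 2 / \<delta> * (e * \<delta> / 2)" using e' \<open>0 < \<delta>\<close> by (intro mult_left_mono) auto
        also have "\<dots> = e" using \<open>0 < \<delta>\<close> by simp
        finally show "\<bar>r t - Re (cnj (lam t) * f (cis t))\<bar> \<le> e" .
        fix z assume z: "z \<in> nt_region K (cis t)"
        have C1: "1 \<le> C" by (simp add: C_def)
        show "norm (f z) \<le> C * (\<bar>r t\<bar> + e)"
        \<comment> \<open>Well inside the disc \<open>f\<close> is small outright; near the circle
          \<open>A z\<close> is close to \<open>A (cis t)\<close> and the kernel is bounded.\<close>
        proof (cases "norm z \<le> \<rho>")
          case True
          have "norm (f z) \<le> 1 * (\<bar>r t\<bar> + e)" using small[OF True] by simp
          also have "\<dots> \<le> C * (\<bar>r t\<bar> + e)" using C1 e by (intro mult_right_mono) auto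
          finally show ?thesis .
        next
          case False
          have z1: "norm z \<le> 1" and zK: "norm (cis t - z) \<le> K * (1 - norm z)"
            using z by (auto simp: nt_region_def)
          have "K * (1 - norm z) < K * (1 - \<rho>)" using False K by simp
          then have "dist z (cis t) < \<eta>" using zK \<rho> by (simp add: dist_norm norm_minus_commute)
          moreover have "z \<in> ?N" "cis t \<in> ?N" using z1 False \<rho> by auto
          ultimately have "dist (A z) (A (cis t)) < e'" using \<eta>(2) by blast
          then have "norm (A z - A (cis t)) < e'" by (simp add: dist_norm)
          moreover have "norm (A z) \<le> norm (A z - A (cis t)) + norm (u t - A (cis t)) + norm (u t)"
            by norm
          moreover have "norm (u t) = \<bar>r t\<bar>" using lam(2) by (simp add: u_def norm_mult)
          ultimately have nA: "norm (A z) \<le> \<bar>r t\<bar> + e" using uA e' by linarith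
          have "\<delta> / (2 * K + 2) \<le> norm (1 - z ^ M)"
            using norm_one_minus_power_ge[OF _ z K \<delta>t] by simp
          then have "2 * norm z ^ M / norm (1 - z ^ M) \<le> 2 * 1 / (\<delta> / (2 * K + 2))"
            using z1 \<open>0 < \<delta>\<close> K by (intro frac_le mult_left_mono power_le_one) auto
          also have "\<dots> \<le> C" by (simp add: C_def)
          finally have "2 * norm z ^ M / norm (1 - z ^ M) \<le> C" .
          moreover have "z \<noteq> 0" using False \<rho> by auto
          ultimately show ?thesis
            using nA e C1 unfolding f_A[OF \<open>z \<noteq> 0\<close>] norm_mult norm_divide norm_power
            by (intro mult_mono) (auto simp: norm_mult norm_power)
        qed
      qed
    qed
  qed
qed

section \<open>Nontangential paths and null sets on the circle\<close>

text \<open>For \<open>v = 1 - cnj \<zeta> * z\<close> the law of cosines gives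
  \<open>1 - (norm z)\<^sup>2 = 2 * Re v - (norm v)\<^sup>2\<close>. The angle condition bounds
  \<open>Re v\<close> below by \<open>c * norm v\<close>, and near \<open>\<zeta>\<close> the square
  is at most \<open>c * norm v\<close>.\<close>

lemma nontangential_path_in_nt_region:
  assumes \<zeta>: "norm \<zeta> = 1" and \<gamma>: "nontangential_path \<gamma> \<zeta>"
  obtains K where "1 \<le> K" "\<forall>\<^sub>F t in at_left 1. \<gamma> t \<in> nt_region K \<zeta> - {\<zeta>}"
proof -
  obtain \<theta> where \<theta>: "\<theta> < pi / 2" "\<forall>\<^sub>F t in at_left 1. \<gamma> t \<in> stolz_angle \<zeta> \<theta>"
    and lim: "(\<gamma> \<longlongrightarrow> \<zeta>) (at_left 1)"
    using \<gamma> unfolding nontangential_path_def by blast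
  \<comment> \<open>The maximum keeps the cosine positive even for a very negative
    \<open>\<theta>\<close>, which the definition of a path does not exclude.\<close>
  define c where "c = cos (max \<theta> 0)"
  have c: "0 < c" "c \<le> 1" using \<theta>(1) pi_gt_zero unfolding c_def by (auto intro!: cos_gt_zero_pi simp: max_def)
  have "\<forall>\<^sub>F t in at_left 1. dist (\<gamma> t) \<zeta> < c"
    using lim c(1) by (rule tendstoD)
  with \<theta>(2) have "\<forall>\<^sub>F t in at_left 1. \<gamma> t \<in> nt_region (2 / c) \<zeta> - {\<zeta>}"
  proof eventually_elim
    case (elim t)
    define z where "z = \<gamma> t"
    define v where "v = 1 - cnj \<zeta> * z"
    have z: "norm z < 1" "\<bar>Arg v\<bar> < \<theta>" "norm (\<zeta> - z) < c"
      using elim by (auto simp: stolz_angle_def z_def v_def dist_norm norm_minus_commute)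
    have one: "cnj \<zeta> * \<zeta> = 1"
      using \<zeta> by (simp add: complex_norm_square[symmetric] mult.commute)
    then have "v = cnj \<zeta> * (\<zeta> - z)" by (simp add: v_def right_diff_distrib)
    then have nv: "norm v = norm (\<zeta> - z)" using \<zeta> by (simp add: norm_mult)
    have "c \<le> cos \<bar>Arg v\<bar>"
      unfolding c_def using z(2) \<theta>(1) by (intro cos_monotone_0_pi_le) auto
    then have "norm v * c \<le> norm v * cos (Arg v)" by (intro mult_left_mono) auto
    also have "\<dots> = Re v"
      by (metis Arg_eq Re_rcis cis_conv_exp mult_zero_left norm_zero rcis_def zero_complex.sel(1))
    finally have Rev: "norm v * c \<le> Re v" .
    have "norm z = norm (1 - v)" using \<zeta> by (simp add: v_def norm_mult)
    then have "(norm z)\<^sup>2 = (1 - Re v)\<^sup>2 + (Im v)\<^sup>2" by (simp add: cmod_power2)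
    also have "\<dots> = 1 - 2 * Re v + (norm v)\<^sup>2"
      unfolding cmod_power2 by (simp add: power2_eq_square algebra_simps)
    finally have "(norm z)\<^sup>2 = 1 - 2 * Re v + (norm v)\<^sup>2" .
    moreover have "(norm v)\<^sup>2 \<le> norm v * c"
      unfolding power2_eq_square using z(3) nv by (intro mult_left_mono) auto
    ultimately have "norm v * c \<le> 1 - (norm z)\<^sup>2" using Rev by linarith
    also have "\<dots> = (1 - norm z) * (1 + norm z)" by (simp add: power2_eq_square algebra_simps)
    also have "\<dots> \<le> (1 - norm z) * 2" using z by (intro mult_left_mono) auto
    finally have "norm (\<zeta> - z) \<le> 2 / c * (1 - norm z)"
      using c nv by (simp add: field_simps)
    then show ?case using z \<zeta> by (auto simp: nt_region_def z_def)
  qed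
  moreover have "1 \<le> 2 / c" using c by simp
  ultimately show thesis using that by blast
qed

lemma nontangential_limitI:
  assumes "norm \<zeta> = 1" "\<And>K. 1 \<le> K \<Longrightarrow> (g \<longlongrightarrow> L) (at \<zeta> within nt_region K \<zeta>)"
  shows "nontangential_limit g \<zeta> L"
  unfolding nontangential_limit_def
proof (intro allI impI)
  fix \<gamma> assume \<gamma>: "nontangential_path \<gamma> \<zeta>"
  obtain K where K: "1 \<le> K" "\<forall>\<^sub>F t in at_left 1. \<gamma> t \<in> nt_region K \<zeta> - {\<zeta>}"
    using nontangential_path_in_nt_region[OF assms(1) \<gamma>] .
  have "filterlim \<gamma> (at \<zeta> within nt_region K \<zeta>) (at_left 1)"
    unfolding filterlim_at using \<gamma> K(2) by (auto simp: nontangential_path_def elim: eventually_mono)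
  with assms(2)[OF K(1)] show "((\<lambda>t. g (\<gamma> t)) \<longlongrightarrow> L) (at_left 1)"
    by (rule filterlim_compose)
qed

text \<open>The exceptional set on the line is covered by countably many translates, by multiples of
  \<open>2 * pi\<close>, of the one in a single period.\<close>

lemma AE_circle:
  assumes "AE t in lebesgue. t \<in> {-pi..pi} \<longrightarrow> P (cis t)"
  shows "AE t in lebesgue. P (cis t)"
proof -
  obtain N where N: "N \<in> null_sets lebesgue" "{t. \<not> (t \<in> {-pi..pi} \<longrightarrow> P (cis t))} \<subseteq> N"
    using assms unfolding eventually_ae_filter by auto
  define U where "U = (\<Union>k::int. (+) (of_int k * (2 * pi)) ` N)"
  have "negligible U"
    unfolding U_def using N(1)
    by (intro negligible_countable_Union)
      (auto intro!: negligible_translation simp flip: negligible_iff_null_sets)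
  moreover have "t \<in> U" if "\<not> P (cis t)" for t
  proof -
    obtain k where k: "t - of_int k * (2 * pi) = Arg (cis t)"
      using Arg_exp_diff_2pi[of "\<i> * of_real t"] by (auto simp: cis_conv_exp)
    define s where "s = Arg (cis t)"
    have "s \<in> {-pi..pi}" using mpi_less_Arg[of "cis t"] Arg_le_pi[of "cis t"] by (auto simp: s_def)
    moreover have "cis s = cis t" unfolding s_def by (simp add: cis_Arg)
    ultimately have "s \<in> N" using N(2) that by auto
    moreover have "t = of_int k * (2 * pi) + s" using k by (simp add: s_def)
    ultimately show ?thesis unfolding U_def by blast
  qed
  ultimately show ?thesis
    by (intro AE_I'[of U]) (auto simp: negligible_iff_null_sets)
qed


section \<open>Summing the corrections\<close>

text \<open>Each correction is applied to the residual left by the one before, and \<open>F\<close>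
  is their sum. The limit \<open>l\<close> of \<open>F\<close> itself is obtained, not just that of
  a real part, so that \<open>F\<close> can later be multiplied by powers of
  \<open>z\<close>.\<close>

lemma boundary_values_exist:
  fixes lam :: "real \<Rightarrow> complex" and \<phi> :: "real \<Rightarrow> real"
  assumes lam: "lam \<in> borel_measurable lebesgue" "\<forall>t. norm (lam t) = 1"
    and \<phi>: "\<phi> \<in> borel_measurable lebesgue"
  obtains F where "F holomorphic_on ball 0 1"
    "AE t in lebesgue. t \<in> {-pi..pi} \<longrightarrow>
      (\<exists>l. Re (cnj (lam t) * l) = \<phi> t \<and> (\<forall>K. (F \<longlongrightarrow> l) (at (cis t) within nt_region K (cis t))))"
proof -
  \<comment> \<open>One geometric sequence bounds the exceptional measures and, up to a factor, the
    terms of the series.\<close>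
  define a :: "nat \<Rightarrow> real" where "a n = (1/2) ^ n" for n
  have a: "0 < a n" "summable a" for n
    by (auto simp: a_def[abs_def] intro!: summable_geometric)
  have "\<forall>n. \<exists>C\<ge>1. \<forall>lam r e. lam \<in> borel_measurable lebesgue \<longrightarrow> (\<forall>t. norm (lam t) = 1) \<longrightarrow>
      r \<in> borel_measurable lebesgue \<longrightarrow> 0 < e \<longrightarrow> e \<le> 1/2 \<longrightarrow>
      (\<exists>f B. correction lam r (a n) (real n + 1) C e f B)"
    using correction_exists[OF a(1)] by simp
  from choice[OF this] obtain C :: "nat \<Rightarrow> real" where C1: "\<And>n. 1 \<le> C n"
    and "\<forall>n lam r e. lam \<in> borel_measurable lebesgue \<longrightarrow> (\<forall>t. norm (lam t) = 1) \<longrightarrow>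
      r \<in> borel_measurable lebesgue \<longrightarrow> 0 < e \<longrightarrow> e \<le> 1/2 \<longrightarrow>
      (\<exists>f B. correction lam r (a n) (real n + 1) (C n) e f B)"
    by blast
  then have C: "\<exists>f B. correction lam r (a n) (real n + 1) (C n) e f B"
    if "r \<in> borel_measurable lebesgue" "0 < e" "e \<le> 1/2" for n r e
    using lam that by blast
  \<comment> \<open>\<open>e n\<close> is amplified twice: by \<open>C n\<close> as the accuracy of
    step \<open>n\<close>, and by \<open>C (Suc n)\<close> as the residual entering the next
    step.\<close>
  define e where "e n = a (Suc n) / (C n * C (Suc n))" for n
  have e0: "0 < e n" for n
    using C1[of n] C1[of "Suc n"] a(1)[of "Suc n"] by (simp add: e_def)
  have Ce: "C n * e n \<le> a n / 2" "C (Suc n) * e n \<le> a n / 2" "e n \<le> a n / 2" for n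
  proof -
    have "C n * e n = a (Suc n) / C (Suc n)" "C (Suc n) * e n = a (Suc n) / C n"
      using C1[of n] C1[of "Suc n"] by (auto simp: e_def)
    moreover have "a (Suc n) / C k \<le> a (Suc n) / 1" for k
      using C1[of k] a(1)[of "Suc n"] by (intro divide_left_mono) auto
    ultimately show Ce': "C n * e n \<le> a n / 2" "C (Suc n) * e n \<le> a n / 2"
      by (auto simp: a_def)
    have "1 * e n \<le> C n * e n" using C1[of n] e0[of n] by (intro mult_right_mono) auto
    then show "e n \<le> a n / 2" using Ce' by simp
  qed
  have e2: "e n \<le> 1/2" for n
  proof -
    have "a n \<le> 1" by (simp add: a_def power_le_one)
    then show ?thesis using Ce(3)[of n] by simp
  qed
  have e_lim: "e \<longlonglongrightarrow> 0"
  proof (rule tendsto_sandwich[of "\<lambda>_. 0" _ _ "\<lambda>n. a n / 2"])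
    show "(\<lambda>n. a n / 2) \<longlonglongrightarrow> 0"
      using tendsto_divide[OF summable_LIMSEQ_zero[OF a(2)] tendsto_const[of 2]] by simp
  qed (use e0 Ce(3) in \<open>auto intro!: always_eventually less_imp_le\<close>)

  \<comment> \<open>The clause for \<open>n = 0\<close> carries the initial residual through the
    dependent choice.\<close>
  define good where "good n r f B \<longleftrightarrow> r \<in> borel_measurable lebesgue \<and> (n = 0 \<longrightarrow> r = \<phi>) \<and>
      correction lam r (a n) (real n + 1) (C n) (e n) f B" for n r f B
  have ex: "\<exists>f B. good n r f B"
    if "r \<in> borel_measurable lebesgue" "n = 0 \<longrightarrow> r = \<phi>" for n r
    using C[OF that(1) e0[of n] e2[of n], of n] that unfolding good_def by blast
  have "\<exists>X. \<forall>n. good n (fst (X n)) (fst (snd (X n))) (snd (snd (X n))) \<and>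
      fst (X (Suc n)) = (\<lambda>t. fst (X n) t - Re (cnj (lam t) * fst (snd (X n)) (cis t)))"
  proof (rule dependent_nat_choice[where P = "\<lambda>n x. good n (fst x) (fst (snd x)) (snd (snd x))" and
        Q = "\<lambda>n x y. fst y = (\<lambda>t. fst x t - Re (cnj (lam t) * fst (snd x) (cis t)))"])
    obtain f B where "good 0 \<phi> f B" using ex[OF \<phi>, of 0] by blast
    then show "\<exists>x. good 0 (fst x) (fst (snd x)) (snd (snd x))"
      by (intro exI[of _ "(\<phi>, f, B)"]) simp
    fix x :: "(real \<Rightarrow> real) \<times> (complex \<Rightarrow> complex) \<times> real set" and n
    assume g: "good n (fst x) (fst (snd x)) (snd (snd x))"
    define r f where "r = fst x" and "f = fst (snd x)"
    have meas: "r \<in> borel_measurable lebesgue" "(\<lambda>t. f (cis t)) \<in> borel_measurable lebesgue"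
      using g unfolding good_def correction_def r_def f_def by blast+
    have "(\<lambda>t. r t - Re (cnj (lam t) * f (cis t))) \<in> borel_measurable lebesgue"
      using meas lam(1) by simp
    from ex[OF this, of "Suc n"] obtain f' B'
      where "good (Suc n) (\<lambda>t. r t - Re (cnj (lam t) * f (cis t))) f' B'" by blast
    then show "\<exists>y. good (Suc n) (fst y) (fst (snd y)) (snd (snd y)) \<and>
        fst y = (\<lambda>t. fst x t - Re (cnj (lam t) * fst (snd x) (cis t)))"
      by (intro exI[of _ "(\<lambda>t. r t - Re (cnj (lam t) * f (cis t)), f', B')"]) (simp add: r_def f_def)
  qed
  then obtain X where X: "\<And>n. good n (fst (X n)) (fst (snd (X n))) (snd (snd (X n)))"
    "\<And>n. fst (X (Suc n)) = (\<lambda>t. fst (X n) t - Re (cnj (lam t) * fst (snd (X n)) (cis t)))"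
    by blast
  define r where "r n = fst (X n)" for n
  define f where "f n = fst (snd (X n))" for n
  define B where "B n = snd (snd (X n))" for n
  have good: "good n (r n) (f n) (B n)" for n
    using X(1)[of n] unfolding r_def f_def B_def .
  have r_Suc: "r (Suc n) t = r n t - Re (cnj (lam t) * f n (cis t))" for n t
    using X(2)[of n] by (simp add: r_def f_def)
  have r_0: "r 0 = \<phi>" using good[of 0] by (simp add: good_def)
  have corr: "correction lam (r n) (a n) (real n + 1) (C n) (e n) (f n) (B n)" for n
    using good by (simp add: good_def)
  have r_sum: "Re (cnj (lam t) * (\<Sum>k<n. f k (cis t))) = \<phi> t - r n t" for n t
    by (induction n) (simp_all add: r_0 r_Suc distrib_left)

  define F where "F z = (\<Sum>n. f n z)" for z
  have hol: "F holomorphic_on ball 0 1"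
  \<comment> \<open>A small closed disc around \<open>x\<close> lies in
    \<open>cball 0 (1 - e n)\<close> for all large \<open>n\<close>, where the terms are at most
    \<open>e n\<close>.\<close>
  proof (rule holomorphic_uniform_sequence[of _ "\<lambda>n z. \<Sum>k<n. f k z"])
    show "(\<lambda>z. \<Sum>k<n. f k z) holomorphic_on ball 0 1" for n
      using corr by (intro holomorphic_intros) (auto simp: correction_def)
    fix x :: complex assume "x \<in> ball 0 1"
    then have x: "norm x < 1" by simp
    define d where "d = (1 - norm x) / 2"
    have d: "0 < d" "norm x + d = 1 - d" using x by (auto simp: d_def field_simps)
    have norm_z: "norm z \<le> 1 - d" if "z \<in> cball x d" for z
      using that d(2) norm_triangle_ineq2[of z x] by (simp add: dist_norm norm_minus_commute)
    have "\<forall>\<^sub>F n in sequentially. e n < d"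
      using e_lim d(1) by (rule order_tendstoD)
    then have "\<forall>\<^sub>F n in sequentially. \<forall>z\<in>cball x d. norm (f n z) \<le> a n"
    proof eventually_elim
      case (elim n)
      show ?case
      proof
        fix z assume "z \<in> cball x d"
        then have "norm z \<le> 1 - e n" using norm_z elim by fastforce
        then have "norm (f n z) \<le> e n" using corr[of n] by (auto simp: correction_def)
        then show "norm (f n z) \<le> a n" using Ce(3)[of n] a(1)[of n] by simp
      qed
    qed
    from Weierstrass_m_test_ev[OF this a(2)]
    have "uniform_limit (cball x d) (\<lambda>n z. \<Sum>k<n. f k z) F sequentially"
      by (simp add: F_def[abs_def])
    moreover have "cball x d \<subseteq> ball 0 1" using norm_z d(1) by fastforce
    ultimately show "\<exists>d>0. cball x d \<subseteq> ball 0 1 \<and> uniform_limit (cball x d) (\<lambda>n z. \<Sum>k<n. f k z) F sequentially"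
      using d(1) by blast
  qed simp

  \<comment> \<open>Borel-Cantelli: almost every \<open>t\<close> lies in only finitely many
    exceptional sets.\<close>
  have "AE t in lebesgue. \<forall>\<^sub>F n in sequentially. t \<in> space lebesgue - B n"
  proof (rule borel_cantelli_AE1)
    have B: "B n \<in> lmeasurable" "measure lebesgue (B n) < a n" for n
      using corr[of n] by (auto simp: correction_def)
    show "B n \<in> sets lebesgue" for n using B by auto
    show "emeasure lebesgue (B n) < \<infinity>" for n 
      using fmeasurableD2[OF B(1)[of n]] unfolding infinity_ennreal_def less_top .
    show "summable (\<lambda>n. measure lebesgue (B n))"
      by (rule summable_comparison_test'[OF a(2), of 0]) (simp add: less_imp_le[OF B(2)])
  qed
  moreover have "AE t in lebesgue. isCont (f n) (cis t)" for n
    using corr[of n] unfolding correction_def by blast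
  then have "AE t in lebesgue. \<forall>n. isCont (f n) (cis t)"
    unfolding AE_all_countable by blast
  ultimately have "AE t in lebesgue. t \<in> {-pi..pi} \<longrightarrow>
      (\<exists>l. Re (cnj (lam t) * l) = \<phi> t \<and> (\<forall>K. (F \<longlongrightarrow> l) (at (cis t) within nt_region K (cis t))))"
  proof eventually_elim
    case (elim t)
    show ?case
    proof (intro impI exI conjI allI)
      assume t: "t \<in> {-pi..pi}"
      obtain N where N: "\<And>n. n \<ge> N \<Longrightarrow> t \<notin> B n"
        using elim(1) by (auto simp: eventually_sequentially)
      have r_le: "\<bar>r (Suc n) t\<bar> \<le> e n" if "n \<ge> N" for n
        using corr[of n] N[OF that] t by (auto simp: correction_def r_Suc)
      \<comment> \<open>Step \<open>n\<close> uses aperture \<open>n + 1\<close>, so every fixed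
        region is covered from some step on.\<close>
      have unif: "uniform_limit (nt_region K (cis t)) (\<lambda>n z. \<Sum>k<n. f k z) F sequentially" for K
      proof -
        have "\<forall>\<^sub>F n in sequentially. K \<le> real n"
          using filterlim_real_sequentially by (simp add: filterlim_at_top)
        then have "\<forall>\<^sub>F n in sequentially. \<forall>z\<in>nt_region K (cis t). norm (f n z) \<le> 2 * a n"
          using eventually_ge_at_top[of "Suc N"]
        proof eventually_elim
          case (elim n)
          show ?case
          proof
            fix z assume z: "z \<in> nt_region K (cis t)"
            then have "K * (1 - norm z) \<le> (real n + 1) * (1 - norm z)"
              using elim(1) by (intro mult_right_mono) (auto simp: nt_region_def)
            with z have "z \<in> nt_region (real n + 1) (cis t)" by (auto simp: nt_region_def)
            then have "norm (f n z) \<le> C n * (\<bar>r n t\<bar> + e n)"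
              using corr[of n] N[of n] elim(2) t by (auto simp: correction_def)
            \<comment> \<open>The residual entering step \<open>n\<close> was left by step
              \<open>m = n - 1\<close>, which must itself be past the last bad set; hence the bound
              \<open>Suc N\<close>.\<close>
            also obtain m where m: "n = Suc m" "m \<ge> N" using elim(2) by (cases n) auto
            have "C n * (\<bar>r n t\<bar> + e n) \<le> C n * (e m + e n)"
              using r_le[of m] m C1[of n] by (intro mult_left_mono) auto
            also have "\<dots> \<le> a m / 2 + a n / 2"
              using Ce(2)[of m] Ce(1)[of n] by (simp add: distrib_left m)
            also have "\<dots> \<le> 2 * a n" by (simp add: a_def m)
            finally show "norm (f n z) \<le> 2 * a n" .
          qed
        qed
        from Weierstrass_m_test_ev[OF this summable_mult[OF a(2)]]
        show ?thesis by (simp add: F_def[abs_def])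
      qed
      \<comment> \<open>The region of aperture 0 is the single boundary point, so this yields
        convergence of the series at \<open>cis t\<close>.\<close>
      have "cis t \<in> nt_region 0 (cis t)" by (simp add: nt_region_def)
      from tendsto_uniform_limitI[OF unif this]
      have lim: "(\<lambda>n. \<Sum>k<n. f k (cis t)) \<longlonglongrightarrow> F (cis t)" .
      show "(F \<longlongrightarrow> F (cis t)) (at (cis t) within nt_region K (cis t))" for K
      \<comment> \<open>The partial sums are continuous at \<open>cis t\<close>, and uniform
        convergence on the region passes this to \<open>F\<close>.\<close>
      proof (rule swap_uniform_limit[OF _ lim unif])
        have "((\<lambda>z. \<Sum>k<n. f k z) \<longlongrightarrow> (\<Sum>k<n. f k (cis t))) (at (cis t) within nt_region K (cis t))" for n
          using elim(2) by (intro tendsto_sum) (auto intro: tendsto_within_subset simp: isCont_def)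
        then show "\<forall>\<^sub>F n in sequentially.
          ((\<lambda>z. \<Sum>k<n. f k z) \<longlongrightarrow> (\<Sum>k<n. f k (cis t))) (at (cis t) within nt_region K (cis t))"
          by simp
      qed simp
      have "(\<lambda>n. r (Suc n) t) \<longlonglongrightarrow> 0"
      proof (rule Lim_null_comparison[OF _ e_lim])
        show "\<forall>\<^sub>F n in sequentially. norm (r (Suc n) t) \<le> e n"
          using r_le by (auto simp: eventually_sequentially)
      qed
      then have "(\<lambda>n. r n t) \<longlonglongrightarrow> 0" by (rule LIMSEQ_imp_Suc)
      then have "(\<lambda>n. \<phi> t - r n t) \<longlonglongrightarrow> \<phi> t - 0" by (intro tendsto_intros)
      moreover have "(\<lambda>n. \<phi> t - r n t) \<longlonglongrightarrow> Re (cnj (lam t) * F (cis t))"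
        unfolding r_sum[symmetric] by (intro tendsto_intros lim)
      ultimately show "Re (cnj (lam t) * F (cis t)) = \<phi> t"
        using LIMSEQ_unique by fastforce
    qed
  qed
  with hol show thesis by (rule that)
qed


section \<open>Solutions of prescribed order at 0 and their independence\<close>

text \<open>On the circle the factor of \<open>F\<close> in the boundary condition is
  \<open>z ^ Suc N\<close>, which has modulus 1 and can be absorbed into \<open>lam\<close>; the
  contribution of \<open>z ^ N\<close> is moved into \<open>\<phi>\<close>. The solution then has
  order exactly \<open>N\<close> at 0.\<close>

lemma RH_solution_with_order:
  fixes lam :: "complex \<Rightarrow> complex" and \<phi> :: "complex \<Rightarrow> real" and N :: nat
  assumes lam: "(\<lambda>t. lam (cis t)) \<in> borel_measurable lebesgue" "\<And>\<zeta>. norm \<zeta> = 1 \<Longrightarrow> norm (lam \<zeta>) = 1"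
    and \<phi>: "(\<lambda>t. \<phi> (cis t)) \<in> borel_measurable lebesgue"
  shows "\<exists>F. F holomorphic_on ball 0 1 \<and> (\<lambda>z. z ^ N * (1 + z * F z)) \<in> RH_solutions lam \<phi>"
proof -
  define lam' where "lam' t = lam (cis t) * cnj (cis t ^ Suc N)" for t
  define \<phi>' where "\<phi>' t = \<phi> (cis t) - Re (cnj (lam (cis t)) * cis t ^ N)" for t
  have cis_meas: "(\<lambda>t. cis t ^ k) \<in> borel_measurable lebesgue"
    "(\<lambda>t. cnj (cis t ^ k)) \<in> borel_measurable lebesgue" for k
    by (intro measurable_completion; auto intro!: borel_measurable_continuous_onI continuous_intros)+
  have "lam' \<in> borel_measurable lebesgue"
    unfolding lam'_def by (intro borel_measurable_times lam(1) cis_meas)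
  moreover have "\<forall>t. norm (lam' t) = 1"
    using lam(2) by (simp add: lam'_def norm_mult norm_power)
  moreover have "\<phi>' \<in> borel_measurable lebesgue"
    unfolding \<phi>'_def using lam(1) \<phi> cis_meas(1)[of N] by simp
  ultimately obtain F where F: "F holomorphic_on ball 0 1"
    "AE t in lebesgue. t \<in> {-pi..pi} \<longrightarrow>
      (\<exists>l. Re (cnj (lam' t) * l) = \<phi>' t \<and> (\<forall>K. (F \<longlongrightarrow> l) (at (cis t) within nt_region K (cis t))))"
    by (rule boundary_values_exist)
  let ?G = "\<lambda>z. z ^ N * (1 + z * F z)"
  have "AE t in lebesgue. t \<in> {-pi..pi} \<longrightarrow>
      nontangential_limit (\<lambda>z. Re (cnj (lam (cis t)) * ?G z)) (cis t) (\<phi> (cis t))"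
    using F(2)
  proof eventually_elim
    case (elim t)
    show ?case
    proof
      assume "t \<in> {-pi..pi}"
      then obtain l where l: "Re (cnj (lam' t) * l) = \<phi>' t"
        and lim: "\<And>K. (F \<longlongrightarrow> l) (at (cis t) within nt_region K (cis t))"
        using elim by blast
      have "cnj (lam (cis t)) * (cis t ^ N * (1 + cis t * l)) =
          cnj (lam (cis t)) * cis t ^ N + cnj (lam' t) * l"
        by (simp add: lam'_def algebra_simps)
      then have "Re (cnj (lam (cis t)) * (cis t ^ N * (1 + cis t * l))) =
          Re (cnj (lam (cis t)) * cis t ^ N + cnj (lam' t) * l)"
        by (rule arg_cong)
      also have "\<dots> = \<phi> (cis t)"
        unfolding plus_complex.sel l \<phi>'_def by simp
      finally have *: "Re (cnj (lam (cis t)) * (cis t ^ N * (1 + cis t * l))) = \<phi> (cis t)" .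
      show "nontangential_limit (\<lambda>z. Re (cnj (lam (cis t)) * ?G z)) (cis t) (\<phi> (cis t))"
      proof (rule nontangential_limitI)
        fix K :: real
        show "((\<lambda>z. Re (cnj (lam (cis t)) * ?G z)) \<longlongrightarrow> \<phi> (cis t)) (at (cis t) within nt_region K (cis t))"
          unfolding *[symmetric] by (intro tendsto_intros lim)
      qed simp
    qed
  qed
  then have "AE t in lebesgue. nontangential_limit (\<lambda>z. Re (cnj (lam (cis t)) * ?G z)) (cis t) (\<phi> (cis t))"
    by (rule AE_circle)
  moreover have "?G holomorphic_on ball 0 1"
    by (intro holomorphic_intros F(1))
  ultimately show ?thesis
    using F(1) unfolding RH_solutions_def by blast
qed

text \<open>By induction the coefficients below \<open>i\<close> vanish. Dividing by
  \<open>z ^ i\<close> and letting \<open>z\<close> tend to 0 isolates \<open>c i\<close>.\<close>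

lemma distinct_orders_independent:
  fixes q :: "nat \<Rightarrow> complex \<Rightarrow> complex" and c :: "nat \<Rightarrow> complex"
  assumes q: "\<And>j. isCont (q j) 0"
    and zero: "\<And>z. z \<in> ball 0 1 \<Longrightarrow> (\<Sum>j<n. c j * (z ^ j * (1 + z * q j z))) = 0"
    and i: "i < n"
  shows "c i = 0"
  using i
proof (induction i rule: less_induct)
  case (less i)
  define H where "H z = (\<Sum>j\<in>{i..<n}. c j * (z ^ (j - i) * (1 + z * q j z)))" for z
  have H0: "H z = 0" if z: "z \<in> ball 0 1" "z \<noteq> 0" for z
  proof -
    have "z ^ i * H z = (\<Sum>j\<in>{i..<n}. c j * (z ^ j * (1 + z * q j z)))"
      unfolding H_def sum_distrib_left
    proof (rule sum.cong)
      fix j assume "j \<in> {i..<n}"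
      then have "z ^ j = z ^ i * z ^ (j - i)" by (simp flip: power_add)
      then show "z ^ i * (c j * (z ^ (j - i) * (1 + z * q j z))) = c j * (z ^ j * (1 + z * q j z))"
        by simp
    qed simp
    also have "\<dots> = (\<Sum>j<n. c j * (z ^ j * (1 + z * q j z)))"
      using less by (intro sum.mono_neutral_left) auto
    also have "\<dots> = 0" by (rule zero[OF z(1)])
    finally show ?thesis using z by simp
  qed
  have "isCont H 0"
    unfolding H_def by (intro continuous_intros q)
  then have "(H \<longlongrightarrow> H 0) (at 0)" by (simp add: isCont_def)
  moreover have "\<forall>\<^sub>F z in at 0. H z = 0"
    using H0 by (auto simp: eventually_at intro!: exI[of _ 1])
  then have "(H \<longlongrightarrow> 0) (at 0)" by (rule tendsto_eventually)
  ultimately have "H 0 = 0" by (rule LIM_unique)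
  moreover have "H 0 = c i"
  proof -
    have "{i..<n} = insert i {Suc i..<n}" using less.prems by auto
    then have "H 0 = c i + (\<Sum>j\<in>{Suc i..<n}. c j * (0 ^ (j - i) * (1 + 0 * q j 0)))"
      unfolding H_def by simp
    also have "(\<Sum>j\<in>{Suc i..<n}. c j * (0 ^ (j - i) * (1 + 0 * q j 0))) = 0"
      by (rule sum.neutral) auto
    finally show ?thesis by simp
  qed
  ultimately show ?case by simp
qed

text \<open>Infinite dimension is expressed by \<open>n\<close> independent differences for every
  \<open>n\<close>. Independence is tested on the disc because the values of these total functions
  elsewhere carry no meaning for the problem.\<close>

theorem theorem5p1:
  fixes lam :: "complex \<Rightarrow> complex" and \<phi> :: "complex \<Rightarrow> real"
  assumes "(\<lambda>t. lam (cis t)) \<in> borel_measurable lebesgue"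
    and "\<And>\<zeta>. norm \<zeta> = 1 \<Longrightarrow> norm (lam \<zeta>) = 1"
    and "(\<lambda>t. \<phi> (cis t)) \<in> borel_measurable lebesgue"
  shows "\<forall>n::nat. \<exists>g :: nat \<Rightarrow> complex \<Rightarrow> complex.
           (\<forall>i<n. \<exists>f1 \<in> RH_solutions lam \<phi>. \<exists>f2 \<in> RH_solutions lam \<phi>. g i = (\<lambda>z. f1 z - f2 z)) \<and>
           (\<forall>c :: nat \<Rightarrow> real. (\<forall>z \<in> ball 0 1. (\<Sum>i<n. of_real (c i) * g i z) = 0) \<longrightarrow> (\<forall>i<n. c i = 0))"
proof -
  obtain F where F: "\<And>N. F N holomorphic_on ball 0 1"
    "\<And>N. (\<lambda>z. z ^ N * (1 + z * F N z)) \<in> RH_solutions lam \<phi>"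
    using RH_solution_with_order[OF assms] by metis
  define f where "f N z = z ^ N * (1 + z * F N z)" for N z
  have f_sol: "f N \<in> RH_solutions lam \<phi>" for N
    using F(2)[of N] by (simp add: f_def[abs_def])
  \<comment> \<open>Chosen so that consecutive differences again have the form
    \<open>z ^ N * (1 + z * q N z)\<close>, of order \<open>N\<close> at 0.\<close>
  define q where "q N z = F N z - 1 - z * F (Suc N) z" for N z
  have diff: "f N z - f (Suc N) z = z ^ N * (1 + z * q N z)" for N z
    by (simp add: f_def q_def algebra_simps)
  have "isCont (F N) 0" for N
    using F(1)[of N] holomorphic_on_imp_continuous_on continuous_on_eq_continuous_at[of "ball 0 1"]
    by fastforce
  then have q: "isCont (q N) 0" for N
    unfolding q_def by (intro continuous_intros)
  show ?thesis
  proof (intro allI exI[of _ "\<lambda>N z. f N z - f (Suc N) z"] conjI impI)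
    fix n i :: nat
    show "\<exists>f1\<in>RH_solutions lam \<phi>. \<exists>f2\<in>RH_solutions lam \<phi>.
        (\<lambda>z. f i z - f (Suc i) z) = (\<lambda>z. f1 z - f2 z)"
      by (rule bexI[OF _ f_sol[of i]], rule bexI[OF _ f_sol[of "Suc i"]], rule refl)
  next
    fix n i :: nat and c :: "nat \<Rightarrow> real"
    assume *: "\<forall>z\<in>ball 0 1. (\<Sum>i<n. of_real (c i) * (f i z - f (Suc i) z)) = 0" and "i < n"
    have "complex_of_real (c i) = 0"
    proof (rule distinct_orders_independent[OF q _ \<open>i < n\<close>])
      show "(\<Sum>j<n. of_real (c j) * (z ^ j * (1 + z * q j z))) = 0" if "z \<in> ball 0 1" for z
        using bspec[OF * that] unfolding diff .
    qed
    then show "c i = 0" by simp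
  qed
qed

end
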